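(* Let $f:\mathbb{Z}_+\to\mathbb{R}$ be an arithmetic function. Then $f$ is L-additive if and only if $f$ is $gh$-decomposable.
   Context: An arithmetic function $g$ is completely additive if $g(mn)=g(m)+g(n)$ for all $m,n\in\mathbb{Z}_+$. An arithmetic function $h$ is completely multiplicative if $h(1)=1$ and $h(mn)=h(m)h(n)$ for all $m,n\in\mathbb{Z}_+$. An arithmetic function $f$ is L-additive if there is a nonzero-valued completely multiplicative function $h_f$ such that $f(mn)=f(m)h_f(n)+f(n)h_f(m)$ for all $m,n\in\mathbb{Z}_+$. An arithmetic function $f$ is $gh$-decomposable if $f=gh$ (pointwise product) for some completely additive $g$ and some nonzero-valued completely multiplicative $h$. *)

theory Defs
  imports Complex_Main
begin

text \<open>
  An arithmetic function \<open>\<int>\<^sub>+ \<rightarrow> \<real>\<close> is represented by a function of type \<^typ>\<open>nat \<Rightarrow> real\<close>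
  of which only the values at positive arguments matter: every definition below quantifies
  over positive arguments only, so the value at \<open>0\<close> is unconstrained.
\<close>

definition completely_additive :: "(nat \<Rightarrow> real) \<Rightarrow> bool" where
  "completely_additive g \<longleftrightarrow> (\<forall>m>0. \<forall>n>0. g (m * n) = g m + g n)"

definition completely_multiplicative :: "(nat \<Rightarrow> real) \<Rightarrow> bool" where
  "completely_multiplicative h \<longleftrightarrow> h 1 = 1 \<and> (\<forall>m>0. \<forall>n>0. h (m * n) = h m * h n)"

definition nonzero_valued :: "(nat \<Rightarrow> real) \<Rightarrow> bool" where
  "nonzero_valued h \<longleftrightarrow> (\<forall>n>0. h n \<noteq> 0)"

definition L_additive :: "(nat \<Rightarrow> real) \<Rightarrow> bool" where
  "L_additive f \<longleftrightarrow>
     (\<exists>h. completely_multiplicative h \<and> nonzero_valued h \<and>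
          (\<forall>m>0. \<forall>n>0. f (m * n) = f m * h n + f n * h m))"

definition gh_decomposable :: "(nat \<Rightarrow> real) \<Rightarrow> bool" where
  "gh_decomposable f \<longleftrightarrow>
     (\<exists>g h. completely_additive g \<and> completely_multiplicative h \<and> nonzero_valued h \<and>
            (\<forall>n>0. f n = g n * h n))"

end

theory Submission
  imports Defs
begin

text \<open>Since \<open>h (m * n) = h m * h n\<close> is nonzero at positive arguments, dividing
  the Leibniz-type rule \<open>f (m * n) = f m * h n + f n * h m\<close> by it gives exactly
  additivity of the quotient \<open>f / h\<close>. So for a fixed \<open>h\<close> the rule says
  that \<open>f / h\<close> is completely additive, and the same \<open>h\<close> serves as witness
  in both directions.\<close>

theorem theorem5:
  fixes f :: "nat \<Rightarrow> real"
  shows "L_additive f \<longleftrightarrow> gh_decomposable f"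
proof
  assume "L_additive f"
  then obtain h where h: "completely_multiplicative h" "nonzero_valued h"
    and f: "\<And>m n. m > 0 \<Longrightarrow> n > 0 \<Longrightarrow> f (m * n) = f m * h n + f n * h m"
    unfolding L_additive_def by blast
  have h_nz: "h n \<noteq> 0" if "n > 0" for n
    using h(2) that unfolding nonzero_valued_def by blast
  have h_mult: "h (m * n) = h m * h n" if "m > 0" "n > 0" for m n
    using h(1) that unfolding completely_multiplicative_def by blast
  \<comment> \<open>The only possible choice at positive arguments, forced by
    \<open>f n = g n * h n\<close>.\<close>
  define g where "g n = f n / h n" for n
  have "completely_additive g"
    unfolding completely_additive_def g_def
    by (auto simp: f h_mult h_nz field_simps)
  moreover have "f n = g n * h n" if "n > 0" for n
    using h_nz[OF that] by (simp add: g_def)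
  ultimately show "gh_decomposable f"
    unfolding gh_decomposable_def using h by blast
next
  assume "gh_decomposable f"
  then obtain g h where g: "completely_additive g"
    and h: "completely_multiplicative h" "nonzero_valued h"
    and f: "\<And>n. n > 0 \<Longrightarrow> f n = g n * h n"
    unfolding gh_decomposable_def by blast
  \<comment> \<open>Expanding \<open>(g m + g n) * (h m * h n)\<close> and absorbing
    \<open>h m\<close> into \<open>g m\<close> and \<open>h n\<close> into \<open>g n\<close> yields
    the two terms of the rule.\<close>
  have "f (m * n) = f m * h n + f n * h m" if "m > 0" "n > 0" for m n
    using g h(1) that unfolding completely_additive_def completely_multiplicative_def
    by (simp add: f algebra_simps)
  then show "L_additive f"
    unfolding L_additive_def using h by blast
qed

end
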